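(* Let $(X,D)$ be an even unbounded Kasparov module over a $\sigma$-unital $C^*$-algebra $B$, let $H\in\mathrm{Lip}_D^{\rm ev}(X)$ be selfadjoint and invertible with gap $g:=\|H^{-1}\|_\infty^{-1}$, and let $\phi:\mathbb R\to[0,1]$ be a localizing function. Let $\kappa\in(0,\infty)$ satisfy $\kappa\cdot\|d(H)\|_\infty<g^2$. If $\rho\in(0,\infty)$ satisfies $$\rho\ge\frac{2g}{\kappa}\quad\text{and}\quad\rho>\frac{c_\phi\cdot\|H\|_\infty\cdot\|d(H)\|_\infty}{g^2-\kappa\cdot\|d(H)\|_\infty},$$ then the pair $(\kappa,\rho)$ is admissible with respect to $(H,D,\phi)$.
   Context: An even unbounded Kasparov module over $B$ is a pair $(X,D)$ with $X$ a countably generated $\mathbb Z/2\mathbb Z$-graded right Hilbert $C^*$-module over $B$ and $D:\mathrm{Dom}(D)\to X$ an odd selfadjoint regular unbounded operator with $(i+D)^{-1}$ compact. $\mathrm{Lip}_D^{\rm ev}(X)$ is the set of even bounded adjointable operators $T$ on $X$ (i.e. commuting with the grading operator) with $T\,\mathrm{Dom}(D)\subseteq\mathrm{Dom}(D)$ and such that $[D,T]:\mathrm{Dom}(D)\to X$ extends to a bounded adjointable operator $d(T)$. $\|\cdot\|_\infty$ is the operator norm and $\|\cdot\|_1$ the $L^1$-norm on $\mathbb R$. A localizing function is an even bounded continuous $L^1$-function $\phi:\mathbb R\to[0,1]$ such that: the support of $\phi$ is in $[-1,1]$ and $\phi(x)=1$ for $x\in[-1/2,1/2]$; $\phi(x_0)\ge\phi(x_1)$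 whenever $0\le x_0\le x_1$; and $p\cdot\widehat\phi(p)$ is $L^1$, where $\widehat\phi(p)=\frac1{\sqrt{2\pi}}\int_{\mathbb R}\phi(x)e^{-ixp}dx$. Put $c_\phi:=\frac{2\|p\,\widehat\phi(p)\|_1}{\sqrt{2\pi}}$ and $C_{\kappa,\rho}:=\big(\kappa+\frac{c_\phi\|H\|_\infty}{\rho}\big)\|d(H)\|_\infty$. The pair $(\kappa,\rho)$ of strictly positive numbers is admissible with respect to $(H,D,\phi)$ if $C_{\kappa,\rho}<\min\{g^2,\frac{\kappa^2\rho^2}{4}\}$. *)

theory Defs
  imports "HOL-Analysis.Analysis"
begin

section \<open>$C^*$-algebras\<close>

class complex_banach = banach +
  fixes scaleC :: "complex \<Rightarrow> 'a \<Rightarrow> 'a"  (infixr "*\<^sub>C" 75)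
  assumes scaleC_add_right: "c *\<^sub>C (x + y) = c *\<^sub>C x + c *\<^sub>C y"
    and scaleC_add_left: "(c + d) *\<^sub>C x = c *\<^sub>C x + d *\<^sub>C x"
    and scaleC_scaleC: "c *\<^sub>C (d *\<^sub>C x) = (c * d) *\<^sub>C x"
    and scaleC_of_real: "complex_of_real r *\<^sub>C x = r *\<^sub>R x"
    and norm_scaleC: "norm (c *\<^sub>C x) = cmod c * norm x"

text \<open>The class \<open>real_normed_algebra\<close> does not require a unit.\<close>

class cstar_algebra = complex_banach + real_normed_algebra +
  fixes cstar :: "'a \<Rightarrow> 'a"
  assumes scaleC_mult_left: "(c *\<^sub>C a) * b = c *\<^sub>C (a * b)"
    and scaleC_mult_right: "a * (c *\<^sub>C b) = c *\<^sub>C (a * b)"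
    and cstar_add: "cstar (a + b) = cstar a + cstar b"
    and cstar_scaleC: "cstar (c *\<^sub>C a) = cnj c *\<^sub>C cstar a"
    and cstar_mult: "cstar (a * b) = cstar b * cstar a"
    and cstar_cstar: "cstar (cstar a) = a"
    and cstar_identity: "norm (cstar a * a) = (norm a)\<^sup>2"

definition cstar_positive :: "'b::cstar_algebra \<Rightarrow> bool" where
  "cstar_positive b \<longleftrightarrow> (\<exists>c. b = cstar c * c)"

text \<open>\<open>\<sigma>\<close>-unital: there is a countable (increasing) approximate unit.\<close>

definition sigma_unital :: "'b::cstar_algebra itself \<Rightarrow> bool" where
  "sigma_unital _ \<longleftrightarrow> (\<exists>u :: nat \<Rightarrow> 'b.
      (\<forall>n. cstar_positive (u n) \<and> norm (u n) \<le> 1 \<and> cstar_positive (u (Suc n) - u n)) \<and>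
      (\<forall>b. (\<lambda>n. u n * b) \<longlonglongrightarrow> b \<and> (\<lambda>n. b * u n) \<longlonglongrightarrow> b))"


section \<open>Hilbert $C^*$-modules and adjointable operators\<close>

locale hilbert_cstar_module =
  fixes act :: "'x::complex_banach \<Rightarrow> 'b::cstar_algebra \<Rightarrow> 'x"
    and ip :: "'x \<Rightarrow> 'x \<Rightarrow> 'b"
  assumes act_add_left: "act (x + y) b = act x b + act y b"
    and act_add_right: "act x (b + c) = act x b + act x c"
    and act_scaleC_left: "act (z *\<^sub>C x) b = z *\<^sub>C act x b"
    and act_scaleC_right: "act x (z *\<^sub>C b) = z *\<^sub>C act x b"
    and act_act: "act (act x b) c = act x (b * c)"
    and ip_add_right: "ip x (y + y') = ip x y + ip x y'"
    and ip_scaleC_right: "ip x (z *\<^sub>C y) = z *\<^sub>C ip x y"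
    and ip_act_right: "ip x (act y b) = ip x y * b"
    and cstar_ip: "cstar (ip x y) = ip y x"
    and ip_positive: "cstar_positive (ip x x)"
    and ip_definite: "ip x x = 0 \<Longrightarrow> x = 0"
    and norm_eq_sqrt_ip: "norm x = sqrt (norm (ip x x))"

definition submodule :: "('x::complex_banach \<Rightarrow> 'b::cstar_algebra \<Rightarrow> 'x) \<Rightarrow> 'x set \<Rightarrow> bool" where
  "submodule act M \<longleftrightarrow> 0 \<in> M \<and> (\<forall>x\<in>M. \<forall>y\<in>M. x + y \<in> M) \<and>
     (\<forall>x\<in>M. \<forall>c. c *\<^sub>C x \<in> M) \<and> (\<forall>x\<in>M. \<forall>b. act x b \<in> M)"

definition countably_generated :: "('x::complex_banach \<Rightarrow> 'b::cstar_algebra \<Rightarrow> 'x) \<Rightarrow> bool" where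
  "countably_generated act \<longleftrightarrow>
     (\<exists>S. countable S \<and> (\<forall>M. submodule act M \<and> closed M \<and> S \<subseteq> M \<longrightarrow> M = UNIV))"

definition adjointable :: "('x::complex_banach \<Rightarrow> 'x \<Rightarrow> 'b::cstar_algebra) \<Rightarrow> ('x \<Rightarrow> 'x) \<Rightarrow> bool" where
  "adjointable ip T \<longleftrightarrow> bounded_linear T \<and> (\<exists>S. \<forall>x y. ip (T x) y = ip x (S y))"

definition selfadjoint :: "('x::complex_banach \<Rightarrow> 'x \<Rightarrow> 'b::cstar_algebra) \<Rightarrow> ('x \<Rightarrow> 'x) \<Rightarrow> bool" where
  "selfadjoint ip T \<longleftrightarrow> adjointable ip T \<and> (\<forall>x y. ip (T x) y = ip x (T y))"

definition invertible_op :: "('x::complex_banach \<Rightarrow> 'x \<Rightarrow> 'b::cstar_algebra) \<Rightarrow> ('x \<Rightarrow> 'x) \<Rightarrow> bool" where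
  "invertible_op ip T \<longleftrightarrow>
     adjointable ip T \<and> (\<exists>S. adjointable ip S \<and> S \<circ> T = id \<and> T \<circ> S = id)"

text \<open>Compact operators: operator-norm limits of finite sums of \<open>z \<mapsto> x \<langle>y, z\<rangle>\<close>.\<close>

definition compact_op ::
  "('x::complex_banach \<Rightarrow> 'b::cstar_algebra \<Rightarrow> 'x) \<Rightarrow> ('x \<Rightarrow> 'x \<Rightarrow> 'b) \<Rightarrow> ('x \<Rightarrow> 'x) \<Rightarrow> bool" where
  "compact_op act ip K \<longleftrightarrow> adjointable ip K \<and>
     (\<forall>e>0. \<exists>(n::nat) x y. onorm (\<lambda>z. K z - (\<Sum>i<n. act (x i) (ip (y i) z))) < e)"


section \<open>Unbounded operators\<close>

text \<open>An unbounded operator is a pair of a domain \<open>domD\<close> and a total function \<open>D\<close>;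
  the values of \<open>D\<close> outside \<open>domD\<close> are never used.\<close>

definition module_linear_on ::
  "('x::complex_banach \<Rightarrow> 'b::cstar_algebra \<Rightarrow> 'x) \<Rightarrow> 'x set \<Rightarrow> ('x \<Rightarrow> 'x) \<Rightarrow> bool" where
  "module_linear_on act domD D \<longleftrightarrow> submodule act domD \<and>
     (\<forall>x\<in>domD. \<forall>y\<in>domD. D (x + y) = D x + D y) \<and>
     (\<forall>x\<in>domD. \<forall>c. D (c *\<^sub>C x) = c *\<^sub>C D x) \<and>
     (\<forall>x\<in>domD. \<forall>b. D (act x b) = act (D x) b)"

definition op_graph :: "'x set \<Rightarrow> ('x \<Rightarrow> 'x) \<Rightarrow> ('x \<times> 'x) set" where
  "op_graph domD D = {(x, D x) |x. x \<in> domD}"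

text \<open>The graph of \<open>D\<^sup>*\<close>.\<close>

definition adjoint_graph ::
  "('x::complex_banach \<Rightarrow> 'x \<Rightarrow> 'b::cstar_algebra) \<Rightarrow> 'x set \<Rightarrow> ('x \<Rightarrow> 'x) \<Rightarrow> ('x \<times> 'x) set" where
  "adjoint_graph ip domD D = {(y, z). \<forall>x\<in>domD. ip (D x) y = ip x z}"

text \<open>Regular: closed, \<open>D\<close> and \<open>D\<^sup>*\<close> densely defined, and \<open>1 + D\<^sup>* D\<close> has dense range.\<close>

definition regular_op ::
  "('x::complex_banach \<Rightarrow> 'b::cstar_algebra \<Rightarrow> 'x) \<Rightarrow> ('x \<Rightarrow> 'x \<Rightarrow> 'b) \<Rightarrow> 'x set \<Rightarrow> ('x \<Rightarrow> 'x) \<Rightarrow> bool" where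
  "regular_op act ip domD D \<longleftrightarrow> module_linear_on act domD D \<and>
     closure domD = UNIV \<and> closed (op_graph domD D) \<and>
     closure (fst ` adjoint_graph ip domD D) = UNIV \<and>
     closure {x + z |x z. x \<in> domD \<and> (D x, z) \<in> adjoint_graph ip domD D} = UNIV"

definition selfadjoint_regular_op ::
  "('x::complex_banach \<Rightarrow> 'b::cstar_algebra \<Rightarrow> 'x) \<Rightarrow> ('x \<Rightarrow> 'x \<Rightarrow> 'b) \<Rightarrow> 'x set \<Rightarrow> ('x \<Rightarrow> 'x) \<Rightarrow> bool" where
  "selfadjoint_regular_op act ip domD D \<longleftrightarrow>
     regular_op act ip domD D \<and> adjoint_graph ip domD D = op_graph domD D"


section \<open>Even unbounded Kasparov modules\<close>

text \<open>The base algebra carries the trivial grading, so the grading operator \<open>gr\<close> of the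
  module is a selfadjoint unitary. For a selfadjoint regular \<open>D\<close> the map \<open>i + D\<close> is a
  bijection from \<open>domD\<close> onto the module, so \<open>inv_into\<close> is its genuine inverse.\<close>

locale even_unbounded_kasparov_module = hilbert_cstar_module act ip
  for act :: "'x::complex_banach \<Rightarrow> 'b::cstar_algebra \<Rightarrow> 'x"
    and ip :: "'x \<Rightarrow> 'x \<Rightarrow> 'b" +
  fixes gr :: "'x \<Rightarrow> 'x" and domD :: "'x set" and D :: "'x \<Rightarrow> 'x"
  assumes countably_generated: "countably_generated act"
    and grading_selfadjoint: "selfadjoint ip gr"
    and grading_involution: "gr \<circ> gr = id"
    and selfadjoint_regular: "selfadjoint_regular_op act ip domD D"
    and grading_dom: "gr ` domD \<subseteq> domD"
    and odd: "\<And>x. x \<in> domD \<Longrightarrow> D (gr x) = - gr (D x)"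
    and compact_resolvent: "compact_op act ip (inv_into domD (\<lambda>x. \<i> *\<^sub>C x + D x))"

definition extends_commutator ::
  "('x::complex_banach \<Rightarrow> 'x \<Rightarrow> 'b::cstar_algebra) \<Rightarrow> 'x set \<Rightarrow> ('x \<Rightarrow> 'x) \<Rightarrow> ('x \<Rightarrow> 'x) \<Rightarrow> ('x \<Rightarrow> 'x) \<Rightarrow> bool" where
  "extends_commutator ip domD D T S \<longleftrightarrow>
     adjointable ip S \<and> (\<forall>x\<in>domD. S x = D (T x) - T (D x))"

definition Lip_ev ::
  "('x::complex_banach \<Rightarrow> 'x \<Rightarrow> 'b::cstar_algebra) \<Rightarrow> ('x \<Rightarrow> 'x) \<Rightarrow> 'x set \<Rightarrow> ('x \<Rightarrow> 'x) \<Rightarrow> ('x \<Rightarrow> 'x) set" where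
  "Lip_ev ip gr domD D = {T. adjointable ip T \<and> T \<circ> gr = gr \<circ> T \<and> T ` domD \<subseteq> domD \<and>
     (\<exists>S. extends_commutator ip domD D T S)}"

definition lip_deriv ::
  "('x::complex_banach \<Rightarrow> 'x \<Rightarrow> 'b::cstar_algebra) \<Rightarrow> 'x set \<Rightarrow> ('x \<Rightarrow> 'x) \<Rightarrow> ('x \<Rightarrow> 'x) \<Rightarrow> 'x \<Rightarrow> 'x" where
  "lip_deriv ip domD D T = (THE S. extends_commutator ip domD D T S)"

lemma lip_deriv_eq:
  assumes dense: "closure domD = UNIV" and S: "extends_commutator ip domD D T S"
  shows "lip_deriv ip domD D T = S"
  unfolding lip_deriv_def
proof (rule the_equality, rule S)
  fix S' assume S': "extends_commutator ip domD D T S'"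
  have bl: "bounded_linear S" "bounded_linear S'"
    using S S' by (auto simp: extends_commutator_def adjointable_def)
  have "closed {x. S' x = S x}"
    using bl by (intro closed_Collect_eq) (auto intro: linear_continuous_on)
  moreover have "domD \<subseteq> {x. S' x = S x}"
    using S S' by (auto simp: extends_commutator_def)
  ultimately have "closure domD \<subseteq> {x. S' x = S x}"
    by (rule closure_minimal[rotated])
  with dense show "S' = S" by auto
qed

definition gap :: "('x::complex_banach \<Rightarrow> 'x) \<Rightarrow> real" where
  "gap H = inverse (onorm (inv H))"


section \<open>Localizing functions and admissibility\<close>

definition fourier :: "(real \<Rightarrow> real) \<Rightarrow> real \<Rightarrow> complex" where
  "fourier \<phi> p = 1 / sqrt (2 * pi) * (LINT x|lborel. complex_of_real (\<phi> x) * exp (- (\<i> * x * p)))"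

definition L1_norm :: "(real \<Rightarrow> complex) \<Rightarrow> real" where
  "L1_norm f = (LINT x|lborel. norm (f x))"

definition localizing_function :: "(real \<Rightarrow> real) \<Rightarrow> bool" where
  "localizing_function \<phi> \<longleftrightarrow>
     (\<forall>x. \<phi> x \<in> {0..1}) \<and> (\<forall>x. \<phi> (- x) = \<phi> x) \<and>
     bounded (range \<phi>) \<and> continuous_on UNIV \<phi> \<and> integrable lborel \<phi> \<and>
     closure {x. \<phi> x \<noteq> 0} \<subseteq> {-1..1} \<and> (\<forall>x\<in>{-1/2..1/2}. \<phi> x = 1) \<and>
     (\<forall>x0 x1. 0 \<le> x0 \<and> x0 \<le> x1 \<longrightarrow> \<phi> x0 \<ge> \<phi> x1) \<and>
     integrable lborel (\<lambda>p. complex_of_real p * fourier \<phi> p)"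

definition localizing_const :: "(real \<Rightarrow> real) \<Rightarrow> real" where
  "localizing_const \<phi> = 2 * L1_norm (\<lambda>p. complex_of_real p * fourier \<phi> p) / sqrt (2 * pi)"

definition admissible_const ::
  "('x::complex_banach \<Rightarrow> 'x \<Rightarrow> 'b::cstar_algebra) \<Rightarrow> ('x \<Rightarrow> 'x) \<Rightarrow> 'x set \<Rightarrow> ('x \<Rightarrow> 'x) \<Rightarrow> (real \<Rightarrow> real) \<Rightarrow>
     real \<Rightarrow> real \<Rightarrow> real" where
  "admissible_const ip H domD D \<phi> \<kappa> \<rho> =
     (\<kappa> + localizing_const \<phi> * onorm H / \<rho>) * onorm (lip_deriv ip domD D H)"

definition admissible ::
  "('x::complex_banach \<Rightarrow> 'x \<Rightarrow> 'b::cstar_algebra) \<Rightarrow> ('x \<Rightarrow> 'x) \<Rightarrow> 'x set \<Rightarrow> ('x \<Rightarrow> 'x) \<Rightarrow> (real \<Rightarrow> real) \<Rightarrow>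
     real \<Rightarrow> real \<Rightarrow> bool" where
  "admissible ip H domD D \<phi> \<kappa> \<rho> \<longleftrightarrow> \<kappa> > 0 \<and> \<rho> > 0 \<and>
     admissible_const ip H domD D \<phi> \<kappa> \<rho> < min ((gap H)\<^sup>2) (\<kappa>\<^sup>2 * \<rho>\<^sup>2 / 4)"

end

theory Submission
  imports Defs
begin

text \<open>
  The hypothesis \<open>\<rho> > c\<^sub>\<phi> \<parallel>H\<parallel> \<parallel>d(H)\<parallel> / (g\<^sup>2 - \<kappa> \<parallel>d(H)\<parallel>)\<close> rearranges, since the denominator is
  positive, to \<open>C\<^sub>\<kappa>\<^sub>,\<^sub>\<rho> < g\<^sup>2\<close>, whereas \<open>\<kappa> \<rho> \<ge> 2 g \<ge> 0\<close> gives \<open>g\<^sup>2 \<le> \<kappa>\<^sup>2 \<rho>\<^sup>2 / 4\<close>. So the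
  minimum in the admissibility condition is \<open>g\<^sup>2\<close>, and the first estimate suffices.
  The only operator-theoretic input is \<open>g \<ge> 0\<close>, which rests on \<open>H\<close> having a bounded inverse.
\<close>

lemma gap_nonneg:
  assumes "invertible_op ip T"
  shows "0 \<le> gap T"
proof -
  obtain S where S: "adjointable ip S" "S \<circ> T = id" "T \<circ> S = id"
    using assms by (auto simp: invertible_op_def)
  have "inv T = S"
    using S(3,2) by (rule inv_unique_comp)
  \<comment> \<open>Boundedness matters: \<open>onorm\<close> is a supremum of reals, hence unspecified for unbounded maps.\<close>
  moreover have "bounded_linear S"
    using S(1) by (simp add: adjointable_def)
  ultimately show ?thesis
    by (simp add: gap_def onorm_pos_le)
qed

theorem proposition6p8:
  fixes act :: "'x::complex_banach \<Rightarrow> 'b::cstar_algebra \<Rightarrow> 'x"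
    and ip :: "'x \<Rightarrow> 'x \<Rightarrow> 'b"
    and gr :: "'x \<Rightarrow> 'x" and domD :: "'x set" and D H :: "'x \<Rightarrow> 'x"
    and \<phi> :: "real \<Rightarrow> real" and \<kappa> \<rho> :: real
  assumes "sigma_unital TYPE('b)"
    and "even_unbounded_kasparov_module act ip gr domD D"
    and "H \<in> Lip_ev ip gr domD D"
    and "selfadjoint ip H"
    and "invertible_op ip H"
    and "localizing_function \<phi>"
    and "\<kappa> > 0"
    and "\<kappa> * onorm (lip_deriv ip domD D H) < (gap H)\<^sup>2"
    and "\<rho> > 0"
    and "\<rho> \<ge> 2 * gap H / \<kappa>"
    and "\<rho> > localizing_const \<phi> * onorm H * onorm (lip_deriv ip domD D H)
               / ((gap H)\<^sup>2 - \<kappa> * onorm (lip_deriv ip domD D H))"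
  shows "admissible ip H domD D \<phi> \<kappa> \<rho>"
proof -
  let ?g = "gap H" and ?d = "onorm (lip_deriv ip domD D H)"
  let ?c = "localizing_const \<phi> * onorm H"
  have g: "0 \<le> ?g"
    using assms(5) by (rule gap_nonneg)
  have "?c * ?d < \<rho> * (?g\<^sup>2 - \<kappa> * ?d)"
    using assms(8,11) by (simp add: pos_divide_less_eq)
  hence "?c * ?d / \<rho> < ?g\<^sup>2 - \<kappa> * ?d"
    using assms(9) by (simp add: pos_divide_less_eq mult.commute)
  hence C_less: "admissible_const ip H domD D \<phi> \<kappa> \<rho> < ?g\<^sup>2"
    by (simp add: admissible_const_def distrib_right)
  have "2 * ?g \<le> \<kappa> * \<rho>"
    using assms(7,10) by (simp add: pos_divide_le_eq mult.commute)
  hence "(2 * ?g)\<^sup>2 \<le> (\<kappa> * \<rho>)\<^sup>2"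
    using g by (intro power_mono) simp_all
  hence "?g\<^sup>2 \<le> \<kappa>\<^sup>2 * \<rho>\<^sup>2 / 4"
    by (simp add: power_mult_distrib)
  with C_less show ?thesis
    using assms(7,9) by (simp add: admissible_def)
qed

end
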